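(* For every integer $k\geq2$, $$C_2(k(k-1))\geq\frac{3k-3}{2k-1}.$$ Moreover, for every integer $k\geq3$, the von Neumann inequality fails for the polynomial $p_{A_k}$: with $l=k(k-1)$, there is a tuple $\boldsymbol T=(T_1,\ldots,T_l)$ of commuting contractions on a complex Hilbert space with $\|p_{A_k}(\boldsymbol T)\|>\|p_{A_k}\|_{\mathbb{D}^l,\infty}$.
   Context: For a polynomial $p$ in $n$ variables, $\|p\|_{\mathbb{D}^n,\infty}=\sup\{|p(z)|:z\in\mathbb{D}^n\}$ is its supremum norm over the unit polydisc $\mathbb{D}^n\subset\mathbb{C}^n$. For $n\in\mathbb{N}$, $$C_2(n)=\sup\{\|p(\boldsymbol T)\|\},$$ where the supremum is over all complex polynomials $p$ of degree at most $2$ in $n$ variables with $\|p\|_{\mathbb{D}^n,\infty}\leq1$ and all $n$-tuples $\boldsymbol T$ of pairwise commuting contractions on some complex Hilbert space. For $l=k(k-1)$, let $F_k=\{v_1,\ldots,v_l\}\subset\mathbb{R}^k$ be the set of all $k$-dimensional vectors with exactly two non-zero components, these being either $1$ and $1$ or $1$ and $-1$, appearing in that order. Let $A_k=(a_{ij})_{1\leq i,j\leq l}$ be the real non-negative definite matrix with $a_{ij}=\langle v_i,v_j\rangle$, and let $p_{A_k}(z_1,\ldots,z_l)=\sum_{i,j=1}^l a_{ij}z_iz_j$. *)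

theory Defs
  imports
    "HOL-Library.Extended_Real"
    "HOL-Library.Poly_Mapping"
    "HOL-Algebra.Algebraic_Closure_Type"
    "Jordan_Normal_Form.Matrix"
begin

subsection \<open>Complex polynomials in finitely many variables\<close>

text \<open>
  A polynomial in \<open>z 0, z 1, \<dots>\<close> maps exponent vectors to coefficients; it is a polynomial in
  \<open>n\<close> variables if only \<open>z 0, \<dots>, z (n - 1)\<close> occur.
\<close>

type_synonym cpoly = "(nat \<Rightarrow>\<^sub>0 nat) \<Rightarrow>\<^sub>0 complex"

definition polys_in :: "nat \<Rightarrow> cpoly set" where
  "polys_in n = {p. \<forall>m \<in> Poly_Mapping.keys p. Poly_Mapping.keys m \<subseteq> {..<n}}"

definition total_degree :: "cpoly \<Rightarrow> nat" where
  "total_degree p =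
     Max (insert 0 ((\<lambda>m. \<Sum>i\<in>Poly_Mapping.keys m. Poly_Mapping.lookup m i) ` Poly_Mapping.keys p))"

definition poly_eval :: "cpoly \<Rightarrow> (nat \<Rightarrow> complex) \<Rightarrow> complex" where
  "poly_eval p z =
     (\<Sum>m\<in>Poly_Mapping.keys p. Poly_Mapping.lookup p m *
        (\<Prod>i\<in>Poly_Mapping.keys m. z i ^ Poly_Mapping.lookup m i))"

text \<open>Points of the polydisc are sequences of which only the first \<open>n\<close> entries matter.\<close>

definition polydisc :: "nat \<Rightarrow> (nat \<Rightarrow> complex) set" where
  "polydisc n = {z. \<forall>i<n. cmod (z i) < 1}"

definition polydisc_norm :: "nat \<Rightarrow> cpoly \<Rightarrow> real" where
  "polydisc_norm n p = (SUP z\<in>polydisc n. cmod (poly_eval p z))"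


subsection \<open>Complex Hilbert spaces and contractions\<close>

text \<open>
  Hilbert spaces are structures with an explicit carrier, so one can quantify over them.
  The inner product is linear in its first argument.  The fields \<open>mult\<close> and \<open>one\<close> inherited
  from the module record play no role.
\<close>

record 'a hilbert = "(complex, 'a) module" +
  cinner :: "'a \<Rightarrow> 'a \<Rightarrow> complex"

definition hnorm :: "('a, 'm) hilbert_scheme \<Rightarrow> 'a \<Rightarrow> real" where
  "hnorm H x = sqrt (Re (cinner H x x))"

locale complex_hilbert_space =
  module "ring_of_type_algebra :: complex ring" H
  for H :: "('a, 'm) hilbert_scheme" (structure) +
  assumes cinner_add_left:
      "\<lbrakk>x \<in> carrier H; y \<in> carrier H; w \<in> carrier H\<rbrakk> \<Longrightarrow>
       cinner H (x \<oplus>\<^bsub>H\<^esub> y) w = cinner H x w + cinner H y w"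
    and cinner_smult_left:
      "\<lbrakk>x \<in> carrier H; y \<in> carrier H\<rbrakk> \<Longrightarrow> cinner H (a \<odot>\<^bsub>H\<^esub> x) y = a * cinner H x y"
    and cinner_commute:
      "\<lbrakk>x \<in> carrier H; y \<in> carrier H\<rbrakk> \<Longrightarrow> cinner H x y = cnj (cinner H y x)"
    and cinner_pos:
      "\<lbrakk>x \<in> carrier H; x \<noteq> \<zero>\<^bsub>H\<^esub>\<rbrakk> \<Longrightarrow> 0 < Re (cinner H x x)"
    and complete:
      "\<lbrakk>\<And>n. s n \<in> carrier H;
        \<And>e. 0 < e \<Longrightarrow> \<exists>N. \<forall>m\<ge>N. \<forall>n\<ge>N. hnorm H (s m \<ominus>\<^bsub>H\<^esub> s n) < e\<rbrakk> \<Longrightarrow>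
       \<exists>x\<in>carrier H. (\<lambda>n. hnorm H (s n \<ominus>\<^bsub>H\<^esub> x)) \<longlonglongrightarrow> 0"

text \<open>Operators are only considered on the carrier; their values elsewhere are irrelevant.\<close>

definition linear_op :: "('a, 'm) hilbert_scheme \<Rightarrow> ('a \<Rightarrow> 'a) \<Rightarrow> bool" where
  "linear_op H A \<longleftrightarrow>
     A \<in> carrier H \<rightarrow> carrier H \<and>
     (\<forall>x\<in>carrier H. \<forall>y\<in>carrier H. A (x \<oplus>\<^bsub>H\<^esub> y) = A x \<oplus>\<^bsub>H\<^esub> A y) \<and>
     (\<forall>c. \<forall>x\<in>carrier H. A (c \<odot>\<^bsub>H\<^esub> x) = c \<odot>\<^bsub>H\<^esub> A x)"

definition contraction :: "('a, 'm) hilbert_scheme \<Rightarrow> ('a \<Rightarrow> 'a) \<Rightarrow> bool" where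
  "contraction H A \<longleftrightarrow> linear_op H A \<and> (\<forall>x\<in>carrier H. hnorm H (A x) \<le> hnorm H x)"

definition commuting_contractions ::
    "('a, 'm) hilbert_scheme \<Rightarrow> nat \<Rightarrow> (nat \<Rightarrow> 'a \<Rightarrow> 'a) \<Rightarrow> bool" where
  "commuting_contractions H n T \<longleftrightarrow>
     (\<forall>i<n. contraction H (T i)) \<and>
     (\<forall>i<n. \<forall>j<n. \<forall>x\<in>carrier H. T i (T j x) = T j (T i x))"

definition op_norm :: "('a, 'm) hilbert_scheme \<Rightarrow> ('a \<Rightarrow> 'a) \<Rightarrow> real" where
  "op_norm H A = (SUP x\<in>{x \<in> carrier H. hnorm H x \<le> 1}. hnorm H (A x))"

text \<open>\<open>monom_op n T m\<close> is \<open>T 0 ^^ m 0 \<circ> T 1 ^^ m 1 \<circ> \<dots> \<circ> T (n - 1) ^^ m (n - 1)\<close>.\<close>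

definition monom_op :: "nat \<Rightarrow> (nat \<Rightarrow> 'a \<Rightarrow> 'a) \<Rightarrow> (nat \<Rightarrow>\<^sub>0 nat) \<Rightarrow> 'a \<Rightarrow> 'a" where
  "monom_op n T m = foldr (\<lambda>i A. (T i ^^ Poly_Mapping.lookup m i) \<circ> A) [0..<n] id"

definition poly_op ::
    "('a, 'm) hilbert_scheme \<Rightarrow> nat \<Rightarrow> cpoly \<Rightarrow> (nat \<Rightarrow> 'a \<Rightarrow> 'a) \<Rightarrow> 'a \<Rightarrow> 'a" where
  "poly_op H n p T x =
     (\<Oplus>\<^bsub>H\<^esub>m\<in>Poly_Mapping.keys p. Poly_Mapping.lookup p m \<odot>\<^bsub>H\<^esub> monom_op n T m x)"


subsection \<open>The constants \<open>C\<^sub>2(n)\<close>\<close>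

text \<open>
  HOL cannot quantify over types inside a term, so the supremum over all Hilbert spaces is taken
  over those whose carrier is a subset of \<open>'i \<Rightarrow> complex\<close>, where the type \<open>'i\<close> is a parameter.
  The operations on the carrier are arbitrary, not the pointwise ones.  Every Hilbert space is
  isomorphic to some \<open>\<ell>\<^sup>2(I)\<close>, whose carrier consists of functions \<open>I \<Rightarrow> complex\<close>.
  The value does not depend on \<open>'i\<close>: the norm of \<open>p(T)\<close> is the supremum of its norms on the
  separable subspaces that are invariant under \<open>T\<close>, and since \<open>'i \<Rightarrow> complex\<close> has at least the
  cardinality of the continuum it carries a copy of every separable Hilbert space.  The supremum
  is taken in the extended reals, so no finiteness is presupposed.
\<close>

definition C2 :: "'i itself \<Rightarrow> nat \<Rightarrow> ereal" where
  "C2 (_ :: 'i itself) n =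
     Sup {ereal (op_norm H (poly_op H n p T)) | p (H :: ('i \<Rightarrow> complex) hilbert) T.
            p \<in> polys_in n \<and> total_degree p \<le> 2 \<and> polydisc_norm n p \<le> 1 \<and>
            complex_hilbert_space H \<and> commuting_contractions H n T}"


subsection \<open>The polynomials \<open>p\<^sub>A\<close> and the vectors \<open>F\<^sub>k\<close>\<close>

definition quadratic_poly :: "real mat \<Rightarrow> cpoly" where
  "quadratic_poly A =
     (\<Sum>i<dim_row A. \<Sum>j<dim_col A.
        Poly_Mapping.single (Poly_Mapping.single i 1 + Poly_Mapping.single j 1)
          (complex_of_real (A $$ (i, j))))"

definition F_vecs :: "nat \<Rightarrow> real vec set" where
  "F_vecs k = {v \<in> carrier_vec k. \<exists>i j. i < j \<and> j < k \<and> v $ i = 1 \<and> (v $ j = 1 \<or> v $ j = - 1) \<and>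
            (\<forall>m<k. m \<noteq> i \<and> m \<noteq> j \<longrightarrow> v $ m = 0)}"

definition gram_mat :: "nat \<Rightarrow> (nat \<Rightarrow> real vec) \<Rightarrow> real mat" where
  "gram_mat l v = mat l l (\<lambda>(i, j). scalar_prod (v i) (v j))"

end

theory Submission
  imports Defs "HOL-Analysis.Convex"
begin

text \<open>
  Write \<open>l = k (k - 1)\<close>, let \<open>v\<^sub>1, \<dots>, v\<^sub>l\<close> enumerate \<open>F\<^sub>k\<close>, and let \<open>p\<close> be the quadratic form of their
  Gram matrix, so \<open>p(z) = (\<Sum>i. v\<^sub>i(1) z\<^sub>i)\<^sup>2 + \<dots> + (\<Sum>i. v\<^sub>i(k) z\<^sub>i)\<^sup>2\<close>.  Two estimates give the
  theorem.

  Upper bound on the polydisc.  Multiplying \<open>z\<close> by a suitable unimodular number makes \<open>p(z)\<close> real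
  and nonnegative, and then \<open>p(z) = Re p(z)\<close> is at most \<open>p(Re z)\<close>.  Hence only real points of
  the cube matter (\<open>sum_squares_cmod_le_real\<close>), where \<open>p(x) = |\<Sum>i. x\<^sub>i v\<^sub>i|\<^sup>2\<close>.  The two vectors of
  \<open>F\<^sub>k\<close> supported on the pair \<open>{i, j}\<close> contribute \<open>x + y\<close> at \<open>i\<close> and \<open>x - y\<close> at \<open>j\<close>, and
  \<open>|x + y| + |x - y| \<le> 2\<close>: up to the factor 2 they divide one point between the players \<open>i\<close> and
  \<open>j\<close>.  So \<open>p(x) / 4\<close> is at most the sum of the squared scores of a tournament with \<open>k\<close> players
  and divisible points, which is largest for the transitive tournament
  (\<open>fractional_score_squares\<close>).  This gives
  \<open>|p| \<le> 4 (0\<^sup>2 + 1\<^sup>2 + \<dots> + (k - 1)\<^sup>2) = 2 k (k - 1) (2 k - 1) / 3\<close>.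

  Lower bound for operators.  For real vectors \<open>u\<^sub>1, \<dots>, u\<^sub>l\<close> of norm at most 1 in \<open>k\<close>-space, let
  \<open>T\<^sub>i\<close> act on the direct sum of a line spanned by \<open>a\<close>, complex \<open>k\<close>-space and a line spanned by
  \<open>b\<close>, by \<open>T\<^sub>i a = u\<^sub>i\<close>, \<open>T\<^sub>i x = \<langle>x, u\<^sub>i\<rangle> b\<close> and \<open>T\<^sub>i b = 0\<close>.  These are contractions, and they commute
  because \<open>T\<^sub>i T\<^sub>j\<close> maps \<open>a\<close> to \<open>\<langle>u\<^sub>i, u\<^sub>j\<rangle> b\<close> and the rest to 0, an expression symmetric in \<open>i\<close> and
  \<open>j\<close> since the \<open>u\<^sub>i\<close> are real.  With \<open>u\<^sub>i = v\<^sub>i / \<surd>2\<close> the norm of \<open>p(T)\<close> is half the sum of the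
  squared entries of the Gram matrix.  That matrix has rank at most \<open>k\<close> and trace \<open>2 l\<close>, so by
  Cauchy-Schwarz this is at least \<open>(2 l)\<^sup>2 / (2 k) = 2 k (k - 1)\<^sup>2\<close>
  (\<open>sum_gram_squares_ge\<close>).

  The quotient of the two bounds is \<open>(3 k - 3) / (2 k - 1)\<close>, which exceeds 1 for \<open>k \<ge> 3\<close>.
\<close>

no_notation fps_nth (infixl \<open>$\<close> 75)

section \<open>Scores of tournaments with divisible points\<close>
text \<open>
  Here \<open>a i j\<close> is the share of the point of the game between \<open>i\<close> and \<open>j\<close> that goes to \<open>i\<close>.  Expanding
  the squared scores gives products \<open>a i j * a i l\<close>.  Those with \<open>j = l\<close> amount to at most 1 for each
  game.  Those with distinct \<open>j\<close> and \<open>l\<close> are grouped by the triple of players: with the shares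
  \<open>p, q, r\<close> around the triangle, the three products are at most
  \<open>p (1 - r) + q (1 - p) + r (1 - q) = 1 - ((1 - p) (1 - q) (1 - r) + p q r) \<le> 1\<close>.  In the resulting
  bound, the number of games plus twice the number of triples, both terms are attained by a
  transitive tournament.
\<close>
lemma fractional_score_squares:
  fixes a :: "nat \<Rightarrow> nat \<Rightarrow> real"
  assumes nonneg: "\<And>i j. i < k \<Longrightarrow> j < k \<Longrightarrow> 0 \<le> a i j"
    and irrefl: "\<And>i. a i i = 0"
    and split: "\<And>i j. i < k \<Longrightarrow> j < k \<Longrightarrow> i \<noteq> j \<Longrightarrow> a i j + a j i \<le> 1"
  shows "(\<Sum>i<k. (\<Sum>j<k. a i j)\<^sup>2) \<le> real k * (real k - 1) * (2 * real k - 1) / 6"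
proof -
  define S where "S = (\<Sum>i<k. (\<Sum>j<k. a i j)\<^sup>2)"
  define Q where "Q = (\<Sum>i<k. \<Sum>j<k. (a i j)\<^sup>2)"
  define \<delta> :: "nat \<Rightarrow> nat \<Rightarrow> real" where "\<delta> = (\<lambda>i j. if i = j then 1 else 0)"
  have S: "S = (\<Sum>i<k. \<Sum>j<k. \<Sum>l<k. a i j * a i l)"
    unfolding S_def by (simp add: power2_eq_square sum_product)
  have S2: "S = (\<Sum>i<k. \<Sum>j<k. \<Sum>l<k. a j l * a j i)"
    unfolding S by (subst sum.swap) (simp add: mult.commute)
  have S3: "S = (\<Sum>i<k. \<Sum>j<k. \<Sum>l<k. a l i * a l j)"
  proof -
    have "S = (\<Sum>l<k. \<Sum>i<k. \<Sum>j<k. a l i * a l j)" by (rule S)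
    also have "\<dots> = (\<Sum>i<k. \<Sum>l<k. \<Sum>j<k. a l i * a l j)" by (rule sum.swap)
    also have "\<dots> = (\<Sum>i<k. \<Sum>j<k. \<Sum>l<k. a l i * a l j)"
      by (intro sum.cong refl sum.swap)
    finally show ?thesis .
  qed
  \<comment> \<open>The terms with \<open>\<delta>\<close> absorb the degenerate triples: the parenthesis is the indicator of
      three distinct players, so that one bound can be summed over all ordered triples.\<close>
  have triple: "a i j * a i l + a j l * a j i + a l i * a l j
      \<le> (1 - \<delta> i j - \<delta> j l - \<delta> i l + 2 * (\<delta> i j * \<delta> j l))
        + \<delta> j l * (a i j)\<^sup>2 + \<delta> i l * (a j i)\<^sup>2 + \<delta> i j * (a l i)\<^sup>2"
    if "i < k" "j < k" "l < k" for i j l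
  proof (cases "i \<noteq> j \<and> j \<noteq> l \<and> i \<noteq> l")
    case True
    define p q r where "p = a i j" and "q = a j l" and "r = a l i"
    have p: "0 \<le> p" "p \<le> 1" "a j i \<le> 1 - p" and q: "0 \<le> q" "q \<le> 1" "a l j \<le> 1 - q"
      and r: "0 \<le> r" "r \<le> 1" "a i l \<le> 1 - r"
      using that True split[of i j] split[of j l] split[of l i] nonneg[of i j] nonneg[of j i]
        nonneg[of j l] nonneg[of l j] nonneg[of l i] nonneg[of i l]
      by (auto simp: p_def q_def r_def)
    have "a i j * a i l + a j l * a j i + a l i * a l j \<le> p * (1 - r) + q * (1 - p) + r * (1 - q)"
      unfolding p_def[symmetric] q_def[symmetric] r_def[symmetric]
      by (intro add_mono mult_left_mono p q r)
    also have "\<dots> = 1 - ((1 - p) * (1 - q) * (1 - r) + p * q * r)"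
      by (simp add: algebra_simps)
    also have "\<dots> \<le> 1"
    proof -
      have "0 \<le> (1 - p) * (1 - q) * (1 - r)" "0 \<le> p * q * r"
        using p q r by simp_all
      then show ?thesis by simp
    qed
    finally show ?thesis using True by (simp add: \<delta>_def)
  next
    case False
    then show ?thesis
      by (auto simp: \<delta>_def irrefl power2_eq_square)
  qed
  have "3 * S = (\<Sum>i<k. \<Sum>j<k. \<Sum>l<k. a i j * a i l + a j l * a j i + a l i * a l j)"
    using S S2 S3 by (simp add: sum.distrib)
  also have "\<dots> \<le> (\<Sum>i<k. \<Sum>j<k. \<Sum>l<k.
        (1 - \<delta> i j - \<delta> j l - \<delta> i l + 2 * (\<delta> i j * \<delta> j l))
        + \<delta> j l * (a i j)\<^sup>2 + \<delta> i l * (a j i)\<^sup>2 + \<delta> i j * (a l i)\<^sup>2)"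
    by (intro sum_mono triple) auto
  also have "\<dots> = real k * (real k - 1) * (real k - 2) + 3 * Q"
  proof -
    have 1: "(\<Sum>i<k. \<Sum>j<k. \<Sum>l<k. 1 - \<delta> i j - \<delta> j l - \<delta> i l + 2 * (\<delta> i j * \<delta> j l))
        = real k * (real k - 1) * (real k - 2)"
      by (simp add: \<delta>_def sum.distrib sum_subtractf algebra_simps flip: sum_distrib_left)
    have 2: "(\<Sum>i<k. \<Sum>j<k. \<Sum>l<k. \<delta> j l * (a i j)\<^sup>2) = Q"
      by (simp add: \<delta>_def Q_def if_distrib[of "\<lambda>x. x * _"] cong: if_cong)
    have 3: "(\<Sum>i<k. \<Sum>j<k. \<Sum>l<k. \<delta> i l * (a j i)\<^sup>2) = Q"
      by (simp add: \<delta>_def Q_def if_distrib[of "\<lambda>x. x * _"] cong: if_cong) (rule sum.swap)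
    have 4: "(\<Sum>i<k. \<Sum>j<k. \<Sum>l<k. \<delta> i j * (a l i)\<^sup>2) = Q"
    proof -
      have "(\<Sum>j<k. \<Sum>l<k. \<delta> i j * (a l i)\<^sup>2) = (\<Sum>l<k. (a l i)\<^sup>2)" if "i < k" for i
        using that by (subst sum.swap) (simp add: \<delta>_def if_distrib[of "\<lambda>x. x * _"] cong: if_cong)
      then have "(\<Sum>i<k. \<Sum>j<k. \<Sum>l<k. \<delta> i j * (a l i)\<^sup>2) = (\<Sum>i<k. \<Sum>l<k. (a l i)\<^sup>2)"
        by simp
      then show ?thesis unfolding Q_def by (subst sum.swap) 
    qed
    show ?thesis
      using 1 2 3 4 by (simp only: sum.distrib)
  qed
  finally have "3 * S \<le> real k * (real k - 1) * (real k - 2) + 3 * Q" .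
  moreover have "2 * Q \<le> real k * (real k - 1)"
  proof -
    have "2 * Q = (\<Sum>i<k. \<Sum>j<k. (a i j)\<^sup>2 + (a j i)\<^sup>2)"
      unfolding sum.distrib Q_def using sum.swap[of "\<lambda>i j. (a i j)\<^sup>2" "{..<k}" "{..<k}"] by simp
    also have "\<dots> \<le> (\<Sum>i<k. \<Sum>j<k. 1 - \<delta> i j)"
    proof (intro sum_mono)
      fix i j assume ij: "i \<in> {..<k}" "j \<in> {..<k}"
      show "(a i j)\<^sup>2 + (a j i)\<^sup>2 \<le> 1 - \<delta> i j"
      proof (cases "i = j")
        case False
        have "(a i j)\<^sup>2 + (a j i)\<^sup>2 \<le> a i j + a j i"
          using False ij split[of i j] nonneg[of i j] nonneg[of j i]
          by (intro add_mono) (auto simp: power2_eq_square mult_left_le)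
        then show ?thesis using False ij split[of i j] by (simp add: \<delta>_def)
      qed (simp add: \<delta>_def irrefl)
    qed
    also have "\<dots> = real k * (real k - 1)"
      by (simp add: \<delta>_def sum_subtractf algebra_simps)
    finally show ?thesis .
  qed
  ultimately show ?thesis
    unfolding S_def[symmetric] by (simp add: field_simps)
qed

section \<open>The vectors of \<open>F\<^sub>k\<close>\<close>
definition pair_vec :: "nat \<Rightarrow> nat \<Rightarrow> nat \<Rightarrow> real \<Rightarrow> real vec" where
  "pair_vec k i j s = vec k (\<lambda>m. if m = i then 1 else if m = j then s else 0)"

lemma index_pair_vec:
  "m < k \<Longrightarrow> pair_vec k i j s $ m = (if m = i then 1 else if m = j then s else 0)"
  by (simp add: pair_vec_def)

lemma pair_vec_in_F_vecs:
  assumes "i < j" "j < k" "s = 1 \<or> s = - 1"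
  shows "pair_vec k i j s \<in> F_vecs k"
proof -
  have "pair_vec k i j s \<in> carrier_vec k"
    by (simp add: pair_vec_def)
  then show ?thesis
    using assms unfolding F_vecs_def
    by (intro CollectI conjI exI[of _ i] exI[of _ j]) (auto simp: index_pair_vec)
qed

lemma F_vecsE:
  assumes "v \<in> F_vecs k"
  obtains i j s where "v = pair_vec k i j s" "i < j" "j < k" "s = 1 \<or> s = - 1"
proof -
  obtain i j where *: "v \<in> carrier_vec k" "i < j" "j < k" "v $ i = 1" "v $ j = 1 \<or> v $ j = - 1"
    "\<And>m. m < k \<Longrightarrow> m \<noteq> i \<Longrightarrow> m \<noteq> j \<Longrightarrow> v $ m = 0"
    using assms by (auto simp: F_vecs_def)
  then have "v = pair_vec k i j (v $ j)"
    by (intro eq_vecI) (auto simp: pair_vec_def)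
  then show ?thesis
    using * that by blast
qed

lemma bij_betw_pair_vec:
  "bij_betw (\<lambda>((i, j), s). pair_vec k i j s) ((SIGMA i:{..<k}. {i<..<k}) \<times> {1, -1}) (F_vecs k)"
  (is "bij_betw ?f ?P _")
proof (rule bij_betw_imageI)
  show "inj_on ?f ?P"
  proof (rule inj_onI)
    fix p q assume p: "p \<in> ?P" and q: "q \<in> ?P"
      and eq: "?f p = ?f q"
    obtain i j s i' j' s' where pq: "p = ((i, j), s)" "q = ((i', j'), s')"
      by (metis surj_pair)
    have same: "pair_vec k i j s = pair_vec k i' j' s'"
      using eq unfolding pq by simp
    have h: "(if m = i then 1 else if m = j then s else 0) =
        (if m = i' then 1 else if m = j' then s' else 0)" if "m < k" for m
      using that arg_cong[OF same, of "\<lambda>v. v $ m"] by (simp only: index_pair_vec)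
    have ord: "i < j" "j < k" "i' < j'" "j' < k"
      using p q unfolding pq mem_Sigma_iff by simp_all
    have s: "s \<noteq> 0"
      using p unfolding pq mem_Sigma_iff by auto
    have "i = i'"
    proof (rule ccontr)
      assume ne: "i \<noteq> i'"
      then have "i = j'" using h[of i] ord by (simp split: if_split_asm)
      moreover have "i' = j" using ne h[of i'] ord by (simp split: if_split_asm)
      ultimately show False using ord by simp
    qed
    moreover from this have "j = j'"
      using h[of j] ord s by (simp split: if_split_asm)
    ultimately show "p = q"
      using h[of j] ord pq by simp
  qed
  show "?f ` ?P = F_vecs k"
  proof (intro equalityI subsetI)
    fix v assume "v \<in> ?f ` ?P"
    then show "v \<in> F_vecs k"
      by (auto intro!: pair_vec_in_F_vecs)
  next
    fix v assume "v \<in> F_vecs k"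
    then obtain i j s where "v = pair_vec k i j s" "i < j" "j < k" "s = 1 \<or> s = - 1"
      by (rule F_vecsE)
    then show "v \<in> ?f ` ?P"
      by (intro image_eqI[of _ _ "((i, j), s)"]) auto
  qed
qed

lemma sum_F_vecs:
  fixes f :: "real vec \<Rightarrow> real"
  shows "(\<Sum>v\<in>F_vecs k. f v) =
    (\<Sum>i<k. \<Sum>j<k. if i < j then f (pair_vec k i j 1) + f (pair_vec k i j (- 1)) else 0)"
proof -
  have "(\<Sum>v\<in>F_vecs k. f v) =
      (\<Sum>((i, j), s)\<in>(SIGMA i:{..<k}. {i<..<k}) \<times> {1, - 1}. f (pair_vec k i j s))"
    using sum.reindex_bij_betw[OF bij_betw_pair_vec, of f k] by (simp add: case_prod_unfold)
  also have "\<dots> = (\<Sum>(i, j)\<in>(SIGMA i:{..<k}. {i<..<k}). \<Sum>s\<in>{1, - 1}. f (pair_vec k i j s))"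
    using sum.cartesian_product[of "\<lambda>p s. f (pair_vec k (fst p) (snd p) s)" "{1, - 1}"
        "SIGMA i:{..<k}. {i<..<k}"]
    by (simp add: case_prod_unfold del: sum.insert)
  also have "\<dots> = (\<Sum>i<k. \<Sum>j\<in>{i<..<k}. f (pair_vec k i j 1) + f (pair_vec k i j (- 1)))"
    by (subst sum.Sigma[symmetric]) auto
  also have "\<dots> = (\<Sum>i<k. \<Sum>j<k. if i < j then f (pair_vec k i j 1) + f (pair_vec k i j (- 1)) else 0)"
    by (intro sum.cong refl sum.mono_neutral_cong_left) auto
  finally show ?thesis .
qed

lemma finite_F_vecs: "finite (F_vecs k)"
  using bij_betw_finite[OF bij_betw_pair_vec, of k] by simp

lemma card_F_vecs: "card (F_vecs k) = k * (k - 1)"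
proof -
  have "card (F_vecs k) = (\<Sum>i<k. k - Suc i) * 2"
    using bij_betw_same_card[OF bij_betw_pair_vec, of k]
    by (simp add: card_cartesian_product numeral_2_eq_2)
  also have "(\<Sum>i<k. k - Suc i) = (\<Sum>i<k. i)"
    by (rule sum.nat_diff_reindex)
  also have "(\<Sum>i<k. i) * 2 = k * (k - 1)"
    by (induction k) (auto simp: algebra_simps)
  finally show ?thesis .
qed

lemma F_vecs_norm:
  fixes v :: "real vec"
  assumes "v \<in> F_vecs k"
  shows "(\<Sum>m<k. (v $ m)\<^sup>2) = 2"
proof -
  obtain i j s where "v = pair_vec k i j s" "i < j" "j < k" "s = 1 \<or> s = -1"
    using assms by (rule F_vecsE)
  moreover from this have "(\<Sum>m<k. (v $ m)\<^sup>2) = (\<Sum>m<k. (if m = i then 1 else 0) + (if m = j then 1 else 0))"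
    by (intro sum.cong) (auto simp: index_pair_vec)
  ultimately show ?thesis
    by (simp add: sum.distrib)
qed

text \<open>
  Collecting the contributions of the pair \<open>{i, j}\<close>, coordinate \<open>i\<close> receives \<open>x + y\<close> and coordinate
  \<open>j\<close> receives \<open>x - y\<close>, where \<open>x\<close> and \<open>y\<close> are the coefficients of the two vectors on that pair.
  Half the absolute values of these contributions are shares in a tournament.
\<close>
lemma F_vecs_combination_bound:
  fixes y :: "real vec \<Rightarrow> real"
  assumes y: "\<And>v. v \<in> F_vecs k \<Longrightarrow> \<bar>y v\<bar> \<le> 1"
  shows "(\<Sum>m<k. (\<Sum>v\<in>F_vecs k. v $ m * y v)\<^sup>2) \<le> 2 * real k * (real k - 1) * (2 * real k - 1) / 3"
proof -
  define c where "c = (\<lambda>i j s. y (pair_vec k i j s))"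
  define b where "b = (\<lambda>m j. if m < j then c m j 1 + c m j (-1) else
      if j < m then c j m 1 - c j m (-1) else 0)"
  have c: "\<bar>c i j s\<bar> \<le> 1" if "i < j" "j < k" "s = 1 \<or> s = -1" for i j s
    unfolding c_def by (intro y pair_vec_in_F_vecs that)
  have coord: "(\<Sum>v\<in>F_vecs k. v $ m * y v) = (\<Sum>j<k. b m j)" if m: "m < k" for m
  proof -
    have "(\<Sum>v\<in>F_vecs k. v $ m * y v) = (\<Sum>i<k. \<Sum>j<k.
        (if m = i then (if i < j then c i j 1 + c i j (-1) else 0) else 0) +
        (if m = j then (if i < j then c i j 1 - c i j (-1) else 0) else 0))"
      unfolding sum_F_vecs by (intro sum.cong refl) (simp add: index_pair_vec[OF m] c_def)
    also have "\<dots> = (\<Sum>j<k. if m < j then c m j 1 + c m j (-1) else 0) +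
        (\<Sum>i<k. if i < m then c i m 1 - c i m (-1) else 0)"
    proof -
      have "(\<Sum>i<k. \<Sum>j<k. if m = i then (if i < j then c i j 1 + c i j (-1) else 0) else 0)
          = (\<Sum>j<k. if m < j then c m j 1 + c m j (-1) else 0)"
        using m by (subst sum.swap) simp
      then show ?thesis using m by (simp add: sum.distrib)
    qed
    also have "\<dots> = (\<Sum>j<k. b m j)"
      unfolding sum.distrib[symmetric] by (intro sum.cong) (auto simp: b_def)
    finally show ?thesis .
  qed
  have "(\<Sum>i<k. (\<Sum>j<k. \<bar>b i j\<bar> / 2)\<^sup>2) \<le> real k * (real k - 1) * (2 * real k - 1) / 6"
  proof (rule fractional_score_squares)
    fix i j assume "i < k" "j < k" "i \<noteq> j"
    have avg: "\<bar>x + y\<bar> / 2 + \<bar>x - y\<bar> / 2 \<le> 1" if "\<bar>x\<bar> \<le> 1" "\<bar>y\<bar> \<le> 1" for x y :: real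
    proof -
      have "\<bar>x + y\<bar> + \<bar>x - y\<bar> \<le> 2"
        using that by linarith
      then show ?thesis
        by (simp add: field_simps)
    qed
    show "\<bar>b i j\<bar> / 2 + \<bar>b j i\<bar> / 2 \<le> 1"
    proof (cases "i < j")
      case True
      then show ?thesis
        using avg[OF c[of i j 1] c[of i j "-1"]] \<open>j < k\<close> by (simp add: b_def)
    next
      case False
      then show ?thesis
        using avg[OF c[of j i 1] c[of j i "-1"]] \<open>i < k\<close> \<open>i \<noteq> j\<close> by (simp add: b_def)
    qed
  qed (auto simp: b_def)
  moreover have "(\<Sum>m<k. (\<Sum>v\<in>F_vecs k. v $ m * y v)\<^sup>2) \<le> (\<Sum>i<k. 4 * (\<Sum>j<k. \<bar>b i j\<bar> / 2)\<^sup>2)"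
  proof (intro sum_mono)
    fix m assume "m \<in> {..<k}"
    then have "(\<Sum>v\<in>F_vecs k. v $ m * y v)\<^sup>2 = (\<Sum>j<k. b m j)\<^sup>2" by (simp add: coord)
    also have "\<dots> \<le> (\<Sum>j<k. \<bar>b m j\<bar>)\<^sup>2"
      by (metis abs_le_square_iff sum_abs abs_of_nonneg sum_nonneg abs_ge_zero)
    also have "\<dots> = 4 * (\<Sum>j<k. \<bar>b m j\<bar> / 2)\<^sup>2"
      by (simp add: sum_divide_distrib[symmetric] power_divide)
    finally show "(\<Sum>v\<in>F_vecs k. v $ m * y v)\<^sup>2 \<le> 4 * (\<Sum>j<k. \<bar>b m j\<bar> / 2)\<^sup>2" .
  qed
  ultimately show ?thesis
    by (simp add: sum_distrib_left[symmetric])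
qed

section \<open>Quadratic polynomials\<close>
text \<open>
  Both \<open>poly_eval\<close> and the coordinates of \<open>poly_op\<close> are sums over the support of the polynomial.  For an
  arbitrary weight \<open>G\<close> on monomials such a sum is additive in the polynomial, whereas the support is
  not; thus it can be computed on a double sum of monomials with possible coincidences and
  cancellations, as in \<open>quadratic_poly\<close>.
\<close>
definition monom_sum :: "((nat \<Rightarrow>\<^sub>0 nat) \<Rightarrow> complex) \<Rightarrow> cpoly \<Rightarrow> complex" where
  "monom_sum G p = (\<Sum>m\<in>Poly_Mapping.keys p. Poly_Mapping.lookup p m * G m)"

lemma monom_sum_superset:
  assumes "finite K" "Poly_Mapping.keys p \<subseteq> K"
  shows "monom_sum G p = (\<Sum>m\<in>K. Poly_Mapping.lookup p m * G m)"
  unfolding monom_sum_def using assms by (intro sum.mono_neutral_left) (auto simp: in_keys_iff)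

lemma monom_sum_add: "monom_sum G (p + q) = monom_sum G p + monom_sum G q"
proof -
  let ?K = "Poly_Mapping.keys p \<union> Poly_Mapping.keys q"
  have "monom_sum G r = (\<Sum>m\<in>?K. Poly_Mapping.lookup r m * G m)" if "r \<in> {p, q, p + q}" for r
    using that keys_add[of p q] by (intro monom_sum_superset) auto
  then show ?thesis
    by (simp add: lookup_add distrib_right sum.distrib)
qed

lemma monom_sum_sum: "monom_sum G (\<Sum>s\<in>S. f s) = (\<Sum>s\<in>S. monom_sum G (f s))"
  by (induction S rule: infinite_finite_induct) (auto simp: monom_sum_add, auto simp: monom_sum_def)

lemma monom_sum_single: "monom_sum G (Poly_Mapping.single m c) = c * G m"
  by (simp add: monom_sum_def)

lemma monom_sum_quadratic_poly:
  "monom_sum G (quadratic_poly A) = (\<Sum>i<dim_row A. \<Sum>j<dim_col A.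
     complex_of_real (A $$ (i, j)) * G (Poly_Mapping.single i 1 + Poly_Mapping.single j 1))"
  by (simp add: quadratic_poly_def monom_sum_sum monom_sum_single)

lemma lookup_pair:
  "Poly_Mapping.lookup (Poly_Mapping.single i 1 + Poly_Mapping.single j 1) r =
    (if r = i then 1 else 0) + (if r = j then (1 :: nat) else 0)"
  by (simp add: lookup_add lookup_single when_def)

lemma keys_pair:
  "Poly_Mapping.keys (Poly_Mapping.single i 1 + Poly_Mapping.single j (1 :: nat)) = {i, j}"
  unfolding set_eq_iff in_keys_iff lookup_pair by simp

lemma poly_eval_quadratic_poly:
  "poly_eval (quadratic_poly A) z =
     (\<Sum>i<dim_row A. \<Sum>j<dim_col A. complex_of_real (A $$ (i, j)) * (z i * z j))"
proof -
  have monom: "(\<Prod>r\<in>{i, j}. z r ^ ((if r = i then 1 else 0) + (if r = j then 1 else 0))) = z i * z j" for i j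
    by (cases "i = j") (simp_all add: power2_eq_square)
  have "poly_eval (quadratic_poly A) z =
      monom_sum (\<lambda>m. \<Prod>r\<in>Poly_Mapping.keys m. z r ^ Poly_Mapping.lookup m r) (quadratic_poly A)"
    unfolding poly_eval_def monom_sum_def by (rule refl)
  then show ?thesis
    by (simp only: monom_sum_quadratic_poly lookup_pair keys_pair monom)
qed

lemma keys_quadratic_poly:
  assumes "m \<in> Poly_Mapping.keys (quadratic_poly A)"
  obtains i j where "i < dim_row A" "j < dim_col A"
    "m = Poly_Mapping.single i 1 + Poly_Mapping.single j 1"
proof -
  let ?s = "\<lambda>i j. Poly_Mapping.single (Poly_Mapping.single i 1 + Poly_Mapping.single j 1)
          (complex_of_real (A $$ (i, j)))"
  have "m \<in> (\<Union>i<dim_row A. \<Union>j<dim_col A. Poly_Mapping.keys (?s i j))"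
  proof -
    obtain i where i: "i < dim_row A" "m \<in> Poly_Mapping.keys (\<Sum>j<dim_col A. ?s i j)"
      using subsetD[OF keys_sum assms[unfolded quadratic_poly_def]] by (elim UN_E) auto
    show ?thesis
      using i(1) subsetD[OF keys_sum i(2)] by (rule UN_I[OF iffD2[OF lessThan_iff]])
  qed
  then show ?thesis
    using that by (auto split: if_split_asm)
qed

lemma quadratic_poly_in_polys_in:
  assumes "dim_row A = l" "dim_col A = l"
  shows "quadratic_poly A \<in> polys_in l"
  unfolding polys_in_def
proof (intro CollectI ballI)
  fix m assume "m \<in> Poly_Mapping.keys (quadratic_poly A)"
  then obtain i j where "i < l" "j < l"
    "m = Poly_Mapping.single i 1 + Poly_Mapping.single j 1"
    using keys_quadratic_poly assms by metis
  then show "Poly_Mapping.keys m \<subseteq> {..<l}"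
    by (simp add: keys_pair del: One_nat_def)
qed

lemma total_degree_quadratic_poly: "total_degree (quadratic_poly A) \<le> 2"
proof -
  have "(\<Sum>r\<in>Poly_Mapping.keys m. Poly_Mapping.lookup m r) \<le> 2"
    if m: "m \<in> Poly_Mapping.keys (quadratic_poly A)" for m
  proof -
    obtain i j where ij: "m = Poly_Mapping.single i 1 + Poly_Mapping.single j 1"
      using keys_quadratic_poly[OF m] by metis
    show ?thesis
      unfolding ij keys_pair lookup_pair by (cases "i = j") simp_all
  qed
  then show ?thesis
    unfolding total_degree_def by (subst Max_le_iff) auto
qed

lemma gram_form:
  fixes z :: "nat \<Rightarrow> complex"
  assumes "\<And>i. i < l \<Longrightarrow> v i \<in> carrier_vec k"
  shows "(\<Sum>i<l. \<Sum>j<l. complex_of_real (v i \<bullet> v j) * (z i * z j)) =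
    (\<Sum>m<k. (\<Sum>i<l. complex_of_real (v i $ m) * z i)\<^sup>2)"
proof -
  have dim: "dim_vec (v i) = k" if "i < l" for i
    using assms[OF that] by (rule carrier_vecD)
  have "(\<Sum>i<l. \<Sum>j<l. complex_of_real (v i \<bullet> v j) * (z i * z j)) =
      (\<Sum>i<l. \<Sum>j<l. \<Sum>m<k. complex_of_real (v i $ m) * z i * (complex_of_real (v j $ m) * z j))"
    by (intro sum.cong refl)
      (simp add: scalar_prod_def dim sum_distrib_left sum_distrib_right atLeast0LessThan mult_ac)
  also have "\<dots> = (\<Sum>i<l. \<Sum>m<k. \<Sum>j<l. complex_of_real (v i $ m) * z i * (complex_of_real (v j $ m) * z j))"
    by (intro sum.cong refl sum.swap)
  also have "\<dots> = (\<Sum>m<k. \<Sum>i<l. \<Sum>j<l. complex_of_real (v i $ m) * z i * (complex_of_real (v j $ m) * z j))"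
    by (rule sum.swap)
  also have "\<dots> = (\<Sum>m<k. (\<Sum>i<l. complex_of_real (v i $ m) * z i)\<^sup>2)"
    by (simp add: power2_eq_square sum_product)
  finally show ?thesis .
qed

text \<open>
  A sum of squares of real linear forms attains its maximum over the closed polydisc at a real point.  After
  a rotation \<open>z \<mapsto> \<omega> z\<close>, which multiplies the form by \<open>\<omega>\<^sup>2\<close>, its value is real and nonnegative; and
  \<open>Re (c\<^sup>2) \<le> (Re c)\<^sup>2\<close> allows passing to real parts in every square.
\<close>
lemma sum_squares_cmod_le_real:
  fixes z :: "nat \<Rightarrow> complex" and w :: "nat \<Rightarrow> nat \<Rightarrow> real"
  assumes real: "\<And>x :: nat \<Rightarrow> real. (\<And>i. i < l \<Longrightarrow> \<bar>x i\<bar> \<le> 1) \<Longrightarrow> (\<Sum>m<k. (\<Sum>i<l. w i m * x i)\<^sup>2) \<le> B"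
    and z: "\<And>i. i < l \<Longrightarrow> cmod (z i) \<le> 1"
  shows "cmod (\<Sum>m<k. (\<Sum>i<l. complex_of_real (w i m) * z i)\<^sup>2) \<le> B"
proof -
  define P where "P = (\<Sum>m<k. (\<Sum>i<l. complex_of_real (w i m) * z i)\<^sup>2)"
  obtain \<omega> where \<omega>: "cmod \<omega> = 1" "\<omega>\<^sup>2 * P = cmod P"
  proof (cases "P = 0")
    case True
    then show ?thesis by (intro that[of 1]) auto
  next
    case False
    define u where "u = csqrt (cnj P / cmod P)"
    have sq: "u\<^sup>2 = cnj P / cmod P" by (simp add: u_def)
    then have "cmod u ^ 2 = 1"
      using False by (simp add: norm_power[symmetric] norm_divide)
    then have "cmod u = 1"
      using norm_ge_zero[of u] by (auto simp: power2_eq_1_iff)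
    moreover have "u\<^sup>2 * P = cmod P"
      unfolding sq using False complex_norm_square[of P] by (simp add: field_simps power2_eq_square)
    ultimately show ?thesis by (rule that)
  qed
  have "complex_of_real (cmod P) = \<omega>\<^sup>2 * P"
    using \<omega>(2) by simp
  also have "\<dots> = (\<Sum>m<k. (\<Sum>i<l. complex_of_real (w i m) * (\<omega> * z i))\<^sup>2)"
    unfolding P_def sum_distrib_left power_mult_distrib[symmetric]
    by (simp add: mult_ac)
  finally have "cmod P = Re (\<Sum>m<k. (\<Sum>i<l. complex_of_real (w i m) * (\<omega> * z i))\<^sup>2)"
    by (metis Re_complex_of_real)
  also have "\<dots> \<le> (\<Sum>m<k. (\<Sum>i<l. w i m * Re (\<omega> * z i))\<^sup>2)"
  proof -
    have sq: "Re (c\<^sup>2) \<le> (Re c)\<^sup>2" for c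
      by (simp add: power2_eq_square)
    have re: "Re (complex_of_real a * c) = a * Re c" for a c
      by simp
    have "Re ((\<Sum>i<l. complex_of_real (w i m) * (\<omega> * z i))\<^sup>2) \<le> (\<Sum>i<l. w i m * Re (\<omega> * z i))\<^sup>2" for m
      using sq[of "\<Sum>i<l. complex_of_real (w i m) * (\<omega> * z i)"] unfolding Re_sum re .
    then show ?thesis
      unfolding Re_sum by (intro sum_mono)
  qed
  also have "\<dots> \<le> B"
  proof (rule real)
    fix i assume "i < l"
    then show "\<bar>Re (\<omega> * z i)\<bar> \<le> 1"
      using abs_Re_le_cmod[of "\<omega> * z i"] z[of i] \<omega>(1) by (simp add: norm_mult)
  qed
  finally show ?thesis unfolding P_def .
qed

text \<open>
  Here \<open>real l * c\<close> is the trace of the Gram matrix, hence also of the \<open>k\<close> by \<open>k\<close> matrix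
  \<open>S = \<Sum>i. w\<^sub>i w\<^sub>i\<^sup>T\<close>, and both matrices have the same sum of squared entries.  For \<open>S\<close> the
  Cauchy-Schwarz inequality applies to its \<open>k\<close> diagonal entries.
\<close>
lemma sum_gram_squares_ge:
  fixes w :: "nat \<Rightarrow> nat \<Rightarrow> real"
  assumes "\<And>i. i < l \<Longrightarrow> (\<Sum>m<k. (w i m)\<^sup>2) = c"
  shows "(real l * c)\<^sup>2 \<le> real k * (\<Sum>i<l. \<Sum>j<l. (\<Sum>m<k. w i m * w j m)\<^sup>2)"
proof -
  let ?s = "\<lambda>m m'. \<Sum>i<l. w i m * w i m'"
  have "real l * c = (\<Sum>i<l. \<Sum>m<k. (w i m)\<^sup>2)"
    using assms by simp
  also have "\<dots> = (\<Sum>m<k. 1 * ?s m m)"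
    by (subst sum.swap) (simp add: power2_eq_square)
  finally have "(real l * c)\<^sup>2 = (\<Sum>m<k. 1 * ?s m m)\<^sup>2"
    by simp
  also have "\<dots> \<le> real k * (\<Sum>m<k. (?s m m)\<^sup>2)"
    using Cauchy_Schwarz_ineq_sum[of "\<lambda>_. 1" "\<lambda>m. ?s m m" "{..<k}"] by simp
  also have "\<dots> \<le> real k * (\<Sum>m<k. \<Sum>m'<k. (?s m m')\<^sup>2)"
    by (intro mult_left_mono sum_mono member_le_sum) auto
  also have "(\<Sum>m<k. \<Sum>m'<k. (?s m m')\<^sup>2) =
      (\<Sum>m<k. \<Sum>m'<k. \<Sum>i<l. \<Sum>j<l. w i m * w i m' * (w j m * w j m'))"
    by (simp add: power2_eq_square sum_product)
  also have "\<dots> = (\<Sum>m<k. \<Sum>i<l. \<Sum>m'<k. \<Sum>j<l. w i m * w i m' * (w j m * w j m'))"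
    by (intro sum.cong refl sum.swap)
  also have "\<dots> = (\<Sum>i<l. \<Sum>m<k. \<Sum>j<l. \<Sum>m'<k. w i m * w i m' * (w j m * w j m'))"
    by (subst sum.swap) (intro sum.cong refl sum.swap)
  also have "\<dots> = (\<Sum>i<l. \<Sum>j<l. \<Sum>m<k. \<Sum>m'<k. w i m * w i m' * (w j m * w j m'))"
    by (intro sum.cong refl sum.swap)
  also have "\<dots> = (\<Sum>i<l. \<Sum>j<l. (\<Sum>m<k. w i m * w j m)\<^sup>2)"
    by (simp add: power2_eq_square sum_product mult_ac)
  finally show ?thesis .
qed

section \<open>Finite-dimensional Hilbert spaces on a given type\<close>
text \<open>
  Iterated pairing: an injective pairing on a type encodes \<open>n\<close> of its elements by one.
\<close>
primrec pack :: "('a \<times> 'a \<Rightarrow> 'a) \<Rightarrow> 'a \<Rightarrow> nat \<Rightarrow> (nat \<Rightarrow> 'a) \<Rightarrow> 'a" where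
  "pack q c 0 f = c"
| "pack q c (Suc n) f = q (f n, pack q c n f)"

lemma pack_inject:
  assumes "inj q" "pack q c n f = pack q c n h" "i < n"
  shows "f i = h i"
  using assms(2,3)
proof (induction n)
  case (Suc n)
  then have "f n = h n" "pack q c n f = pack q c n h"
    using assms(1) by (auto dest: injD)
  with Suc show ?case by (auto simp: less_Suc_eq)
qed simp

definition fin_space :: "nat \<Rightarrow> (nat \<Rightarrow> complex) set" where
  "fin_space n = {f. \<forall>i\<ge>n. f i = 0}"

text \<open>
  However small the index type \<open>'i\<close> is, the constant functions alone give room for a copy of
  \<open>n\<close>-dimensional space, because complex numbers can be paired injectively.
\<close>
lemma ex_inj_on_fin_space:
  "\<exists>g :: (nat \<Rightarrow> complex) \<Rightarrow> 'i \<Rightarrow> complex. inj_on g (fin_space n)"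
proof -
  have "infinite (UNIV :: complex set)"
    by (rule infinite_UNIV_char_0)
  then obtain q :: "complex \<times> complex \<Rightarrow> complex" where "bij_betw q (UNIV \<times> UNIV) UNIV"
    using card_of_Times_same_infinite card_of_ordIso by blast
  then have q: "inj q"
    by (simp add: bij_betw_def)
  show ?thesis
  proof (rule exI, rule inj_onI, rule ext)
    fix f h i assume fh: "f \<in> fin_space n" "h \<in> fin_space n"
      and eq: "(\<lambda>u :: 'i. pack q 0 n f) = (\<lambda>_. pack q 0 n h)"
    show "f i = h i"
    proof (cases "i < n")
      case True
      then show ?thesis using pack_inject[OF q fun_cong[OF eq]] by simp
    qed (use fh in \<open>simp add: fin_space_def\<close>)
  qed
qed

text \<open>
  The space of \<open>n\<close>-tuples has to be realised on a prescribed type \<open>'b\<close>.  The map \<open>g\<close> is an encoding of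
  tuples in \<open>'b\<close> and \<open>d\<close> reads off the coordinates; the Hilbert space \<open>H\<close> is the image of \<open>g\<close> with
  the structure transported along it.
\<close>
locale coordinates =
  fixes n :: nat and g :: "(nat \<Rightarrow> complex) \<Rightarrow> 'b" and d :: "'b \<Rightarrow> nat \<Rightarrow> complex"
  assumes d_g: "f \<in> fin_space n \<Longrightarrow> d (g f) = f"
begin

definition H :: "'b hilbert" where
  "H = \<lparr>partial_object.carrier = g ` fin_space n, monoid.mult = (\<lambda>x y. x), monoid.one = g (\<lambda>_. 0),
     ring.zero = g (\<lambda>_. 0), ring.add = (\<lambda>x y. g (\<lambda>i. d x i + d y i)),
     module.smult = (\<lambda>c x. g (\<lambda>i. c * d x i)),
     hilbert.cinner = (\<lambda>x y. \<Sum>i<n. d x i * cnj (d y i))\<rparr>"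

lemma carrier_H: "x \<in> carrier H \<longleftrightarrow> (\<exists>f\<in>fin_space n. x = g f)"
  by (auto simp: H_def)

lemma g_closed [simp, intro]: "f \<in> fin_space n \<Longrightarrow> g f \<in> carrier H"
  by (auto simp: carrier_H)

lemma g_d: "x \<in> carrier H \<Longrightarrow> g (d x) = x"
  by (auto simp: carrier_H d_g)

lemma d_closed: "x \<in> carrier H \<Longrightarrow> d x \<in> fin_space n"
  by (auto simp: carrier_H d_g)

lemma d_beyond: "x \<in> carrier H \<Longrightarrow> n \<le> i \<Longrightarrow> d x i = 0"
  using d_closed by (auto simp: fin_space_def)

lemma carrier_eqI: "x \<in> carrier H \<Longrightarrow> y \<in> carrier H \<Longrightarrow> (\<And>i. d x i = d y i) \<Longrightarrow> x = y"
  by (metis g_d ext)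

lemma add_H: "x \<oplus>\<^bsub>H\<^esub> y = g (\<lambda>i. d x i + d y i)"
  and smult_H: "c \<odot>\<^bsub>H\<^esub> x = g (\<lambda>i. c * d x i)"
  and zero_H: "\<zero>\<^bsub>H\<^esub> = g (\<lambda>_. 0)"
  and cinner_H: "cinner H x y = (\<Sum>i<n. d x i * cnj (d y i))"
  by (simp_all add: H_def)

lemma fin_space_ops:
  "x \<in> carrier H \<Longrightarrow> y \<in> carrier H \<Longrightarrow> (\<lambda>i. d x i + d y i) \<in> fin_space n"
  "x \<in> carrier H \<Longrightarrow> (\<lambda>i. c * d x i) \<in> fin_space n"
  "(\<lambda>_. 0) \<in> fin_space n"
  by (simp_all add: fin_space_def d_beyond)

lemma add_closed [simp]: "x \<in> carrier H \<Longrightarrow> y \<in> carrier H \<Longrightarrow> x \<oplus>\<^bsub>H\<^esub> y \<in> carrier H"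
  and scale_closed [simp]: "x \<in> carrier H \<Longrightarrow> c \<odot>\<^bsub>H\<^esub> x \<in> carrier H"
  and zero_in_carrier [simp]: "\<zero>\<^bsub>H\<^esub> \<in> carrier H"
  by (simp_all add: add_H smult_H zero_H fin_space_ops)

lemma d_add [simp]: "x \<in> carrier H \<Longrightarrow> y \<in> carrier H \<Longrightarrow> d (x \<oplus>\<^bsub>H\<^esub> y) i = d x i + d y i"
  and d_smult [simp]: "x \<in> carrier H \<Longrightarrow> d (c \<odot>\<^bsub>H\<^esub> x) i = c * d x i"
  and d_zero [simp]: "d \<zero>\<^bsub>H\<^esub> i = 0"
  by (simp_all add: add_H smult_H zero_H fin_space_ops d_g)

lemma abelian_group_H: "abelian_group H"
proof (rule abelian_groupI)
  fix x assume x: "x \<in> carrier H"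
  show "\<exists>y\<in>carrier H. y \<oplus>\<^bsub>H\<^esub> x = \<zero>\<^bsub>H\<^esub>"
    using x by (intro bexI[of _ "(- 1) \<odot>\<^bsub>H\<^esub> x"] carrier_eqI) simp_all
qed (auto intro!: carrier_eqI)

lemma hnorm_H: "hnorm H x = sqrt (\<Sum>i<n. (cmod (d x i))\<^sup>2)"
proof -
  have "Re (c * cnj c) = (cmod c)\<^sup>2" for c
    by (metis Re_complex_of_real complex_norm_square of_real_power)
  then show ?thesis
    by (simp only: hnorm_def cinner_H Re_sum)
qed

lemma d_minus:
  assumes "x \<in> carrier H" "y \<in> carrier H"
  shows "d (x \<ominus>\<^bsub>H\<^esub> y) i = d x i - d y i"
proof -
  interpret abelian_group H by (rule abelian_group_H)
  have "(x \<ominus>\<^bsub>H\<^esub> y) \<oplus>\<^bsub>H\<^esub> y = x"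
    using assms by (simp add: a_minus_def a_assoc l_neg)
  then show ?thesis
    using d_add[of "x \<ominus>\<^bsub>H\<^esub> y" y i] assms by simp
qed

text \<open>
  Each coordinate of a Cauchy sequence is a Cauchy sequence of complex numbers, and coordinatewise
  convergence is convergence in norm since there are finitely many coordinates.
\<close>
lemma complete_H:
  assumes s: "\<And>m. s m \<in> carrier H"
    and cauchy: "\<And>e. 0 < e \<Longrightarrow> \<exists>N. \<forall>m\<ge>N. \<forall>m'\<ge>N. hnorm H (s m \<ominus>\<^bsub>H\<^esub> s m') < e"
  shows "\<exists>x\<in>carrier H. (\<lambda>m. hnorm H (s m \<ominus>\<^bsub>H\<^esub> x)) \<longlonglongrightarrow> 0"
proof -
  have le: "cmod (d (s m) i - d (s m') i) \<le> hnorm H (s m \<ominus>\<^bsub>H\<^esub> s m')" if "i < n" for i m m'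
    unfolding hnorm_H d_minus[OF s s] using that
    by (intro real_le_rsqrt member_le_sum) auto
  have "convergent (\<lambda>m. d (s m) i)" if "i < n" for i
  proof (rule Cauchy_convergent, rule metric_CauchyI)
    fix e :: real assume "0 < e"
    from cauchy[OF this] show "\<exists>N. \<forall>m\<ge>N. \<forall>m'\<ge>N. dist (d (s m) i) (d (s m') i) < e"
      using le[OF that] unfolding dist_norm by (meson le_less_trans)
  qed
  then obtain L where L: "(\<lambda>m. d (s m) i) \<longlonglongrightarrow> L i" if "i < n" for i
    unfolding convergent_def by metis
  define f where "f = (\<lambda>i. if i < n then L i else 0)"
  have f: "f \<in> fin_space n" by (simp add: f_def fin_space_def)
  have "(\<lambda>m. sqrt (\<Sum>i<n. (cmod (d (s m) i - L i))\<^sup>2)) \<longlonglongrightarrow> sqrt (\<Sum>i<n. (cmod (L i - L i))\<^sup>2)"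
    by (intro tendsto_intros L) auto
  moreover have "hnorm H (s m \<ominus>\<^bsub>H\<^esub> g f) = sqrt (\<Sum>i<n. (cmod (d (s m) i - L i))\<^sup>2)" for m
  proof -
    have "hnorm H (s m \<ominus>\<^bsub>H\<^esub> g f) = sqrt (\<Sum>i<n. (cmod (d (s m) i - f i))\<^sup>2)"
      by (simp add: hnorm_H d_minus s f d_g)
    then show ?thesis by (simp add: f_def)
  qed
  ultimately show ?thesis
    using f by (intro bexI[of _ "g f"]) auto
qed

lemma module_H: "module (ring_of_type_algebra :: complex ring) H"
proof (rule moduleI)
  show "cring (ring_of_type_algebra :: complex ring)"
    by (rule cring_from_type_algebra)
  show "abelian_group H"
    by (rule abelian_group_H)
qed (auto simp: ring_of_type_algebra_def algebra_simps intro!: carrier_eqI)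

lemma complex_hilbert_space_H: "complex_hilbert_space H"
proof (intro complex_hilbert_space.intro module_H complex_hilbert_space_axioms.intro)
  fix x y w and c
  assume x: "x \<in> carrier H" and y: "y \<in> carrier H"
  show "cinner H (c \<odot>\<^bsub>H\<^esub> x) y = c * cinner H x y"
    using x by (simp add: cinner_H sum_distrib_left mult_ac)
  show "cinner H x y = cnj (cinner H y x)"
    by (simp add: cinner_H mult_ac)
  show "cinner H (x \<oplus>\<^bsub>H\<^esub> y) w = cinner H x w + cinner H y w"
    using x y by (simp add: cinner_H sum.distrib distrib_right)
next
  fix x assume x: "x \<in> carrier H" "x \<noteq> \<zero>\<^bsub>H\<^esub>"
  then obtain i where i: "d x i \<noteq> 0"
    using carrier_eqI[of x "\<zero>\<^bsub>H\<^esub>"] by auto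
  then have "i < n"
    using d_beyond[OF x(1)] by (meson not_le)
  then have "0 < (\<Sum>i<n. (cmod (d x i))\<^sup>2)"
    using i by (intro sum_pos2[of _ i]) auto
  then have "0 < hnorm H x"
    by (simp add: hnorm_H)
  then show "0 < Re (cinner H x x)"
    by (simp add: hnorm_def)
qed (rule complete_H)

lemma d_finsum:
  assumes "F \<in> A \<rightarrow> carrier H"
  shows "d (\<Oplus>\<^bsub>H\<^esub>a\<in>A. F a) i = (\<Sum>a\<in>A. d (F a) i)"
proof -
  interpret abelian_group H by (rule abelian_group_H)
  show ?thesis
    using assms
  proof (induction A rule: infinite_finite_induct)
    case (insert a A)
    then have "(\<Oplus>\<^bsub>H\<^esub>a\<in>insert a A. F a) = F a \<oplus>\<^bsub>H\<^esub> (\<Oplus>\<^bsub>H\<^esub>a\<in>A. F a)"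
      by (intro finsum_insert) auto
    with insert show ?case
      by (simp add: Pi_iff finsum_closed)
  qed (simp_all add: finsum_infinite)
qed

end

section \<open>Monomials of degree two in commuting operators\<close>
lemma upt_split: "a \<le> m \<Longrightarrow> m < b \<Longrightarrow> [a..<b] = [a..<m] @ m # [Suc m..<b]"
  using upt_add_eq_append[of a m "b - m"] by (simp add: upt_conv_Cons)

lemma foldr_powers_id:
  assumes "\<And>i. i \<in> set xs \<Longrightarrow> e i = 0"
  shows "foldr (\<lambda>i A. (T i ^^ e i) \<circ> A) xs h = h"
  using assms by (induction xs) simp_all

lemma monom_op_pair_less:
  fixes T :: "nat \<Rightarrow> 'a \<Rightarrow> 'a"
  assumes "i < j" "j < l"
  shows "monom_op l T (Poly_Mapping.single i 1 + Poly_Mapping.single j 1) = T i \<circ> T j"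
proof -
  have "[0..<l] = [0..<i] @ i # [Suc i..<j] @ j # [Suc j..<l]"
    using assms upt_split[of 0 i l] upt_split[of "Suc i" j l] by simp
  moreover have "foldr (\<lambda>r A. (T r ^^ ((if r = i then 1 else 0) + (if r = j then 1 else 0))) \<circ> A) xs h = h"
    if "i \<notin> set xs" "j \<notin> set xs" for xs and h :: "'a \<Rightarrow> 'a"
    using that by (intro foldr_powers_id) auto
  ultimately show ?thesis
    unfolding monom_op_def lookup_pair using assms by simp
qed

lemma monom_op_square:
  fixes T :: "nat \<Rightarrow> 'a \<Rightarrow> 'a"
  assumes "i < l"
  shows "monom_op l T (Poly_Mapping.single i 1 + Poly_Mapping.single i 1) = T i \<circ> T i"
proof -
  have "[0..<l] = [0..<i] @ i # [Suc i..<l]"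
    using assms by (simp add: upt_split)
  moreover have "foldr (\<lambda>r A. (T r ^^ ((if r = i then 1 else 0) + (if r = i then 1 else 0))) \<circ> A) xs h = h"
    if "i \<notin> set xs" for xs and h :: "'a \<Rightarrow> 'a"
    using that by (intro foldr_powers_id) auto
  ultimately show ?thesis
    unfolding monom_op_def lookup_pair by (simp add: o_assoc)
qed

lemma monom_op_pair:
  assumes "i < l" "j < l" and commute: "\<And>i j. T i \<circ> T j = T j \<circ> T i"
  shows "monom_op l T (Poly_Mapping.single i 1 + Poly_Mapping.single j 1) = T i \<circ> T j"
proof (cases i j rule: linorder_cases)
  case less
  then show ?thesis using assms by (simp only: monom_op_pair_less)
next
  case equal
  then show ?thesis using assms by (simp only: monom_op_square)
next
  case greater
  then have "monom_op l T (Poly_Mapping.single j 1 + Poly_Mapping.single i 1) = T j \<circ> T i"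
    using assms by (simp only: monom_op_pair_less)
  then show ?thesis by (simp only: add.commute commute)
qed

section \<open>Commuting contractions attached to vectors\<close>
text \<open>
  Coordinates \<open>0, \<dots>, k - 1\<close> form the middle space, coordinate \<open>k\<close> is the line that is mapped into it,
  and coordinate \<open>k + 1\<close> is the line into which it is mapped.  The dimension is kept as a variable \<open>n\<close>
  with \<open>n = k + 2\<close>, because the simplifier would rewrite a literal \<open>k + 2\<close> inside \<open>H\<close> to successor form.
\<close>
locale nilpotent_tuple = coordinates n g d
  for n :: nat and g :: "(nat \<Rightarrow> complex) \<Rightarrow> 'b" and d :: "'b \<Rightarrow> nat \<Rightarrow> complex" +
  fixes k :: nat and u :: "nat \<Rightarrow> nat \<Rightarrow> real"
  assumes n: "n = k + 2"
begin

definition shift :: "nat \<Rightarrow> (nat \<Rightarrow> complex) \<Rightarrow> nat \<Rightarrow> complex" where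
  "shift i f = (\<lambda>m. if m < k then complex_of_real (u i m) * f k
     else if m = k + 1 then \<Sum>r<k. complex_of_real (u i r) * f r else 0)"

definition T :: "nat \<Rightarrow> 'b \<Rightarrow> 'b" where
  "T i x = g (shift i (d x))"

lemma shift_fin_space: "shift i f \<in> fin_space n"
  by (simp add: shift_def fin_space_def n)

lemma T_closed: "T i x \<in> carrier H"
  by (simp add: T_def shift_fin_space)

lemma d_T: "d (T i x) = shift i (d x)"
  by (simp add: T_def d_g shift_fin_space)

lemma d_T_T:
  "d (T i (T j x)) = (\<lambda>m. if m = k + 1 then complex_of_real (\<Sum>r<k. u i r * u j r) * d x k else 0)"
  by (rule ext) (simp add: d_T shift_def sum_distrib_right mult.assoc)

lemma T_commute: "T i \<circ> T j = T j \<circ> T i"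
proof
  fix x
  show "(T i \<circ> T j) x = (T j \<circ> T i) x"
    by (rule carrier_eqI) (simp_all add: T_closed d_T_T mult.commute)
qed

lemma linear_T: "linear_op H (T i)"
  unfolding linear_op_def
  by (auto simp: T_closed d_T shift_def distrib_left sum.distrib sum_distrib_left mult_ac
      intro!: carrier_eqI)

lemma hnorm_sq: "(hnorm H x)\<^sup>2 = (\<Sum>m<k. (cmod (d x m))\<^sup>2) + (cmod (d x k))\<^sup>2 + (cmod (d x (k + 1)))\<^sup>2"
proof -
  have "(hnorm H x)\<^sup>2 = (\<Sum>i<n. (cmod (d x i))\<^sup>2)"
    by (simp add: hnorm_H sum_nonneg)
  also have "\<dots> = (\<Sum>m<k. (cmod (d x m))\<^sup>2) + (cmod (d x k))\<^sup>2 + (cmod (d x (k + 1)))\<^sup>2"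
    by (simp add: n)
  finally show ?thesis .
qed

text \<open>
  The operator sends the line \<open>k\<close> to the middle space and the middle space to the line \<open>k + 1\<close>, with
  norm at most 1 in each case; source and target components are orthogonal, so the squared norms add.
\<close>
lemma contraction_T:
  assumes u: "(\<Sum>r<k. (u i r)\<^sup>2) \<le> 1"
  shows "contraction H (T i)"
  unfolding contraction_def
proof (intro conjI ballI linear_T)
  fix x assume "x \<in> carrier H"
  have "(cmod (\<Sum>r<k. complex_of_real (u i r) * d x r))\<^sup>2 \<le> (\<Sum>r<k. \<bar>u i r\<bar> * cmod (d x r))\<^sup>2"
    by (intro power_mono order_trans[OF norm_sum]) (auto simp: norm_mult)
  also have "\<dots> \<le> (\<Sum>r<k. (\<bar>u i r\<bar>)\<^sup>2) * (\<Sum>r<k. (cmod (d x r))\<^sup>2)"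
    by (rule Cauchy_Schwarz_ineq_sum)
  also have "\<dots> \<le> 1 * (\<Sum>r<k. (cmod (d x r))\<^sup>2)"
    using u by (intro mult_right_mono) (auto intro: sum_nonneg)
  finally have "(cmod (d (T i x) (k + 1)))\<^sup>2 \<le> (\<Sum>r<k. (cmod (d x r))\<^sup>2)"
    by (simp add: d_T shift_def)
  moreover have "(\<Sum>m<k. (cmod (d (T i x) m))\<^sup>2) \<le> (cmod (d x k))\<^sup>2"
  proof -
    have "(\<Sum>m<k. (cmod (d (T i x) m))\<^sup>2) = (\<Sum>m<k. (u i m)\<^sup>2) * (cmod (d x k))\<^sup>2"
      by (simp add: d_T shift_def norm_mult power_mult_distrib sum_distrib_right)
    also have "\<dots> \<le> 1 * (cmod (d x k))\<^sup>2"
      using u by (intro mult_right_mono) auto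
    finally show ?thesis by simp
  qed
  moreover have "(cmod (d (T i x) k))\<^sup>2 = 0"
    by (simp add: d_T shift_def)
  moreover have "0 \<le> (cmod (d x (k + 1)))\<^sup>2"
    by (rule zero_le_power2)
  ultimately have "(hnorm H (T i x))\<^sup>2 \<le> (hnorm H x)\<^sup>2"
    unfolding hnorm_sq by linarith
  then show "hnorm H (T i x) \<le> hnorm H x"
    by (rule power2_le_imp_le) (simp add: hnorm_H sum_nonneg)
qed

lemma commuting_contractions_T:
  assumes "\<And>i. i < l \<Longrightarrow> (\<Sum>r<k. (u i r)\<^sup>2) \<le> 1"
  shows "commuting_contractions H l T"
  unfolding commuting_contractions_def
  using assms contraction_T fun_cong[OF T_commute] by (simp add: o_def)

text \<open>
  Every product of two of the operators is a multiple of one rank-one map, from coordinate \<open>k\<close> to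
  coordinate \<open>k + 1\<close>, so \<open>p(T)\<close> is a multiple of that map as well.
\<close>
lemma hnorm_poly_op:
  assumes A: "dim_row A = l" "dim_col A = l" and x: "x \<in> carrier H"
  shows "hnorm H (poly_op H l (quadratic_poly A) T x) =
    \<bar>\<Sum>i<l. \<Sum>j<l. A $$ (i, j) * (\<Sum>r<k. u i r * u j r)\<bar> * cmod (d x k)"
proof -
  let ?p = "quadratic_poly A"
  let ?C = "\<Sum>i<l. \<Sum>j<l. A $$ (i, j) * (\<Sum>r<k. u i r * u j r)"
  have monom: "monom_op l T (Poly_Mapping.single i 1 + Poly_Mapping.single j 1) x = T i (T j x)"
    if "i < l" "j < l" for i j
    using monom_op_pair[OF that T_commute] by simp
  have closed: "monom_op l T m x \<in> carrier H" if m: "m \<in> Poly_Mapping.keys ?p" for m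
  proof -
    obtain i j where "i < l" "j < l" "m = Poly_Mapping.single i 1 + Poly_Mapping.single j 1"
      using keys_quadratic_poly[OF m] A by metis
    then show ?thesis
      using monom T_closed by simp
  qed
  have "d (poly_op H l ?p T x) m = (if m = k + 1 then complex_of_real ?C * d x k else 0)" for m
  proof -
    have "d (poly_op H l ?p T x) m = monom_sum (\<lambda>\<mu>. d (monom_op l T \<mu> x) m) ?p"
      unfolding poly_op_def monom_sum_def using closed
      by (subst d_finsum) (auto intro!: sum.cong)
    also have "\<dots> = (\<Sum>i<l. \<Sum>j<l. complex_of_real (A $$ (i, j)) * d (T i (T j x)) m)"
      unfolding monom_sum_quadratic_poly A by (intro sum.cong refl) (simp only: monom lessThan_iff)
    also have "\<dots> = (if m = k + 1 then complex_of_real ?C * d x k else 0)"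
      by (simp add: d_T_T sum_distrib_right mult.assoc)
    finally show ?thesis .
  qed
  then have "(hnorm H (poly_op H l ?p T x))\<^sup>2 = (\<bar>?C\<bar> * cmod (d x k))\<^sup>2"
    unfolding hnorm_sq by (simp add: norm_mult power_mult_distrib del: of_real_sum of_real_mult)
  then show ?thesis
    by (rule power2_eq_imp_eq) (simp_all add: hnorm_H sum_nonneg)
qed

text \<open>
  The bound is attained at the unit vector of coordinate \<open>k\<close>.  Since \<open>op_norm\<close> is a supremum of reals,
  boundedness of the values on the unit ball has to be established before it can be used.
\<close>
lemma op_norm_poly_op_ge:
  assumes A: "dim_row A = l" "dim_col A = l"
  shows "(\<Sum>i<l. \<Sum>j<l. A $$ (i, j) * (\<Sum>r<k. u i r * u j r)) \<le> op_norm H (poly_op H l (quadratic_poly A) T)"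
proof -
  let ?C = "\<Sum>i<l. \<Sum>j<l. A $$ (i, j) * (\<Sum>r<k. u i r * u j r)"
  let ?P = "poly_op H l (quadratic_poly A) T"
  define e where "e = (\<lambda>m. if m = k then 1 else 0 :: complex)"
  have e: "e \<in> fin_space n" by (simp add: e_def fin_space_def n)
  have "(hnorm H (g e))\<^sup>2 = 1"
    unfolding hnorm_sq d_g[OF e] by (simp add: e_def)
  then have e1: "hnorm H (g e) \<le> 1"
    by (metis order_refl power2_le_imp_le power_one zero_le_one)
  have "bdd_above ((\<lambda>x. hnorm H (?P x)) ` {x \<in> carrier H. hnorm H x \<le> 1})"
  proof (rule bdd_aboveI2)
    fix x assume x: "x \<in> {x \<in> carrier H. hnorm H x \<le> 1}"
    have "(cmod (d x k))\<^sup>2 \<le> (hnorm H x)\<^sup>2"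
      unfolding hnorm_sq by (simp add: sum_nonneg)
    then have "cmod (d x k) \<le> hnorm H x"
      by (rule power2_le_imp_le) (simp add: hnorm_H sum_nonneg)
    then show "hnorm H (?P x) \<le> \<bar>?C\<bar>"
      using x hnorm_poly_op[OF A, of x] by (simp add: mult_left_le)
  qed
  then have "hnorm H (?P (g e)) \<le> op_norm H ?P"
    unfolding op_norm_def using e e1 by (intro cSUP_upper) auto
  moreover have "hnorm H (?P (g e)) = \<bar>?C\<bar>"
    using hnorm_poly_op[OF A g_closed[OF e]] by (simp add: d_g[OF e]) (simp add: e_def)
  ultimately show ?thesis by simp
qed

end

section \<open>The two estimates and the theorem\<close>
lemma sum_F_vecs_enum:
  assumes "bij_betw v {..<l} (F_vecs k)"
  shows "(\<Sum>i<l. v i $ m * x i) = (\<Sum>w\<in>F_vecs k. w $ m * x (inv_into {..<l} v w))"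
  using assms
  by (subst sum.reindex_bij_betw[OF assms, symmetric])
    (auto simp: bij_betw_def inv_into_f_f intro!: sum.cong)

text \<open>
  The factor \<open>c\<close> in this estimate and the next serves to normalise the polynomial, as the definition of
  \<open>C2\<close> demands.
\<close>
lemma polydisc_norm_gram_le:
  assumes v: "bij_betw v {..<l} (F_vecs k)" and "0 \<le> c"
  shows "polydisc_norm l (quadratic_poly (c \<cdot>\<^sub>m gram_mat l v))
    \<le> c * (2 * real k * (real k - 1) * (2 * real k - 1) / 3)"
  unfolding polydisc_norm_def
proof (rule cSUP_least)
  have "(\<lambda>_. 0) \<in> polydisc l" by (simp add: polydisc_def)
  then show "polydisc l \<noteq> {}" by blast
next
  fix z assume z: "z \<in> polydisc l"
  have F: "v i \<in> F_vecs k" if "i < l" for i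
    using that v by (auto simp: bij_betw_def)
  then have dim: "v i \<in> carrier_vec k" if "i < l" for i
    using that by (simp add: F_vecs_def)
  have "poly_eval (quadratic_poly (c \<cdot>\<^sub>m gram_mat l v)) z =
      complex_of_real c * (\<Sum>i<l. \<Sum>j<l. complex_of_real (v i \<bullet> v j) * (z i * z j))"
    by (simp add: poly_eval_quadratic_poly gram_mat_def sum_distrib_left mult.assoc)
  also have "\<dots> = complex_of_real c * (\<Sum>m<k. (\<Sum>i<l. complex_of_real (v i $ m) * z i)\<^sup>2)"
    by (simp only: gram_form[OF dim])
  finally have "cmod (poly_eval (quadratic_poly (c \<cdot>\<^sub>m gram_mat l v)) z) =
      c * cmod (\<Sum>m<k. (\<Sum>i<l. complex_of_real (v i $ m) * z i)\<^sup>2)"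
    using \<open>0 \<le> c\<close> by (simp add: norm_mult)
  also have "\<dots> \<le> c * (2 * real k * (real k - 1) * (2 * real k - 1) / 3)"
  proof (intro mult_left_mono \<open>0 \<le> c\<close> sum_squares_cmod_le_real)
    fix x :: "nat \<Rightarrow> real" assume x: "\<And>i. i < l \<Longrightarrow> \<bar>x i\<bar> \<le> 1"
    have "\<bar>x (inv_into {..<l} v w)\<bar> \<le> 1" if "w \<in> F_vecs k" for w
      using that v by (intro x) (metis bij_betw_def inv_into_into lessThan_iff)
    then show "(\<Sum>m<k. (\<Sum>i<l. v i $ m * x i)\<^sup>2) \<le> 2 * real k * (real k - 1) * (2 * real k - 1) / 3"
      unfolding sum_F_vecs_enum[OF v] by (rule F_vecs_combination_bound)
  qed (use z in \<open>simp add: polydisc_def less_imp_le\<close>)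
  finally show "cmod (poly_eval (quadratic_poly (c \<cdot>\<^sub>m gram_mat l v)) z)
      \<le> c * (2 * real k * (real k - 1) * (2 * real k - 1) / 3)" .
qed

text \<open>
  With \<open>u\<^sub>i = v\<^sub>i / \<surd>2\<close> the inner products \<open>\<langle>u\<^sub>i, u\<^sub>j\<rangle>\<close> are half the Gram entries, so pairing them with the
  Gram matrix gives half the sum of its squared entries.
\<close>
lemma ex_contractions_gram:
  assumes v: "bij_betw v {..<k * (k - 1)} (F_vecs k)" and "0 \<le> c" "1 \<le> k"
  shows "\<exists>(H :: ('i \<Rightarrow> complex) hilbert) T.
    complex_hilbert_space H \<and> commuting_contractions H (k * (k - 1)) T \<and>
    c * (2 * real k * (real k - 1)\<^sup>2) \<le>
      op_norm H (poly_op H (k * (k - 1)) (quadratic_poly (c \<cdot>\<^sub>m gram_mat (k * (k - 1)) v)) T)"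
proof -
  define l where "l = k * (k - 1)"
  have F: "v i \<in> F_vecs k" if "i < l" for i
    using that v by (auto simp: bij_betw_def l_def)
  have dim: "dim_vec (v i) = k" if "i < l" for i
    using F[OF that] by (simp add: F_vecs_def)
  obtain g :: "(nat \<Rightarrow> complex) \<Rightarrow> 'i \<Rightarrow> complex" where g: "inj_on g (fin_space (k + 2))"
    using ex_inj_on_fin_space by blast
  define u where "u = (\<lambda>i r. v i $ r / sqrt 2)"
  interpret nilpotent_tuple "k + 2" g "inv_into (fin_space (k + 2)) g" k u
    by unfold_locales (use g in \<open>simp_all add: inv_into_f_f\<close>)
  have "(\<Sum>r<k. (u i r)\<^sup>2) \<le> 1" if "i < l" for i
    using F_vecs_norm[OF F[OF that]] by (simp add: u_def power_divide sum_divide_distrib[symmetric])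
  then have contr: "commuting_contractions H l T"
    by (rule commuting_contractions_T)
  let ?S = "\<Sum>i<l. \<Sum>j<l. (\<Sum>m<k. v i $ m * v j $ m)\<^sup>2"
  have "(real l * 2)\<^sup>2 \<le> real k * ?S"
    by (rule sum_gram_squares_ge) (rule F_vecs_norm[OF F])
  moreover have "(real l * 2)\<^sup>2 = real k * (4 * real k * (real k - 1)\<^sup>2)"
    using \<open>1 \<le> k\<close> by (simp add: l_def power2_eq_square of_nat_diff)
  ultimately have "real k * (4 * real k * (real k - 1)\<^sup>2) \<le> real k * ?S"
    by (simp only:)
  then have "4 * real k * (real k - 1)\<^sup>2 \<le> ?S"
    by (rule mult_left_le_imp_le) (use \<open>1 \<le> k\<close> in simp)
  then have "c * (2 * real k * (real k - 1)\<^sup>2) \<le> c * (?S / 2)"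
    using \<open>0 \<le> c\<close> by (intro mult_left_mono) simp_all
  also have "\<dots> = (\<Sum>i<l. \<Sum>j<l. (c \<cdot>\<^sub>m gram_mat l v) $$ (i, j) * (\<Sum>r<k. u i r * u j r))"
  proof -
    have "(c \<cdot>\<^sub>m gram_mat l v) $$ (i, j) * (\<Sum>r<k. u i r * u j r) = c * ((\<Sum>m<k. v i $ m * v j $ m)\<^sup>2 / 2)"
      if "i < l" "j < l" for i j
      using that dim
      by (simp add: gram_mat_def scalar_prod_def u_def atLeast0LessThan power2_eq_square
          sum_divide_distrib[symmetric])
    then have "(\<Sum>i<l. \<Sum>j<l. (c \<cdot>\<^sub>m gram_mat l v) $$ (i, j) * (\<Sum>r<k. u i r * u j r)) =
        (\<Sum>i<l. \<Sum>j<l. c * ((\<Sum>m<k. v i $ m * v j $ m)\<^sup>2 / 2))"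
      by (intro sum.cong refl) (simp only: lessThan_iff)
    then show ?thesis
      by (simp only: sum_distrib_left sum_divide_distrib)
  qed
  also have "\<dots> \<le> op_norm H (poly_op H l (quadratic_poly (c \<cdot>\<^sub>m gram_mat l v)) T)"
    by (rule op_norm_poly_op_ge) (simp_all add: gram_mat_def)
  finally show ?thesis
    using complex_hilbert_space_H contr unfolding l_def by blast
qed

theorem mainTheorem5:
  fixes k :: nat
  shows "(k \<ge> 2 \<longrightarrow>
            C2 TYPE('i) (k * (k - 1)) \<ge> ereal ((3 * real k - 3) / (2 * real k - 1))) \<and>
         (k \<ge> 3 \<longrightarrow>
            (\<forall>v. bij_betw v {..<k * (k - 1)} (F_vecs k) \<longrightarrow>
              (let l = k * (k - 1); p = quadratic_poly (gram_mat l v) in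
                \<exists>(H :: ('i \<Rightarrow> complex) hilbert) T.
                  complex_hilbert_space H \<and> commuting_contractions H l T \<and>
                  op_norm H (poly_op H l p T) > polydisc_norm l p)))"
proof (intro conjI impI allI)
  assume k: "k \<ge> 2"
  let ?l = "k * (k - 1)"
  obtain v where v: "bij_betw v {..<?l} (F_vecs k)"
    using ex_bij_betw_nat_finite[OF finite_F_vecs, of k] by (auto simp: card_F_vecs atLeast0LessThan)
  define B where "B = 2 * real k * (real k - 1) * (2 * real k - 1) / 3"
  have B: "B > 0" using k by (simp add: B_def)
  define p where "p = quadratic_poly ((1 / B) \<cdot>\<^sub>m gram_mat ?l v)"
  obtain H :: "('i \<Rightarrow> complex) hilbert" and T where HT:
    "complex_hilbert_space H" "commuting_contractions H ?l T"
    "1 / B * (2 * real k * (real k - 1)\<^sup>2) \<le> op_norm H (poly_op H ?l p T)"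
    using ex_contractions_gram[OF v, of "1 / B"] k B unfolding p_def by auto
  have "p \<in> polys_in ?l" "total_degree p \<le> 2"
    unfolding p_def by (intro quadratic_poly_in_polys_in total_degree_quadratic_poly; simp add: gram_mat_def)+
  moreover have "polydisc_norm ?l p \<le> 1"
    using polydisc_norm_gram_le[OF v, of "1 / B"] B unfolding p_def B_def[symmetric] by simp
  ultimately have "ereal (op_norm H (poly_op H ?l p T)) \<le> C2 TYPE('i) ?l"
    unfolding C2_def using HT by (intro Sup_upper) blast
  moreover have "1 / B * (2 * real k * (real k - 1)\<^sup>2) = (3 * real k - 3) / (2 * real k - 1)"
  proof -
    have "1 / (2 * r * t * q / 3) * (2 * r * t\<^sup>2) = 3 * t / q" if "r > 0" "t > 0" "q > 0" for r t q :: real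
      using that by (simp add: field_simps power2_eq_square)
    from this[of "real k" "real k - 1" "2 * real k - 1"] show ?thesis
      using k by (simp add: B_def right_diff_distrib)
  qed
  ultimately show "C2 TYPE('i) ?l \<ge> ereal ((3 * real k - 3) / (2 * real k - 1))"
    using HT(3) by (metis ereal_less_eq(3) order_trans)
next
  fix v assume k: "k \<ge> 3" and v: "bij_betw v {..<k * (k - 1)} (F_vecs k)"
  let ?l = "k * (k - 1)"
  have one: "1 \<cdot>\<^sub>m gram_mat ?l v = gram_mat ?l v"
    by (rule eq_matI) simp_all
  obtain H :: "('i \<Rightarrow> complex) hilbert" and T where HT:
    "complex_hilbert_space H" "commuting_contractions H ?l T"
    "2 * real k * (real k - 1)\<^sup>2 \<le> op_norm H (poly_op H ?l (quadratic_poly (gram_mat ?l v)) T)"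
    using ex_contractions_gram[OF v, of 1] k unfolding one by auto
  have "polydisc_norm ?l (quadratic_poly (gram_mat ?l v)) \<le> 2 * real k * (real k - 1) * (2 * real k - 1) / 3"
    using polydisc_norm_gram_le[OF v, of 1] unfolding one by simp
  also have "\<dots> < 2 * real k * (real k - 1)\<^sup>2"
  proof -
    have "0 < 2 * real k * (real k - 1) * (real k - 2)"
      using k by simp
    then show ?thesis
      by (simp add: field_simps power2_eq_square)
  qed
  finally show "let l = ?l; p = quadratic_poly (gram_mat l v) in
                \<exists>(H :: ('i \<Rightarrow> complex) hilbert) T.
                  complex_hilbert_space H \<and> commuting_contractions H l T \<and>
                  op_norm H (poly_op H l p T) > polydisc_norm l p"
    unfolding Let_def using HT by (meson less_le_trans)
qed

end
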